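(* Let $\mathcal{D}\subset\mathbb{R}^m$ and $\mathbf{L}\in\mathbb{R}^{m\times m}$. Suppose $f\in\mathcal{L}(\mathcal{D},\mathbf{L})$, $\widetilde f\in\mathcal{L}(\mathcal{D},\mathbf{L}\mathbf{U}\mathbf{U}^\top)$ where $\mathbf{U}\in\mathbb{R}^{m\times n}$ and $\mathbf{U}^\top\mathbf{U}=\mathbf{I}$, and $\{\mathbf{x}_j\}_{j=1}^M\subset\mathcal{D}$. Then $$\max_{\mathbf{x}\in\mathcal{D}}|f(\mathbf{x})-\widetilde f(\mathbf{x})|\le\max_{j=1,\dots,M}|f(\mathbf{x}_j)-\widetilde f(\mathbf{x}_j)|+2\max_{\mathbf{x}\in\mathcal{D}}\min_{j=1,\dots,M}\|\mathbf{L}\mathbf{U}\mathbf{U}^\top(\mathbf{x}_j-\mathbf{x})\|_2+\sigma_{\max}\big(\mathbf{L}(\mathbf{I}-\mathbf{U}\mathbf{U}^\top)\big)\cdot\operatorname{diam}(\mathcal{D}),$$ where $\sigma_{\max}(\mathbf{A})$ denotes the largest singular value of $\mathbf{A}$ and $\operatorname{diam}(\mathcal{D})=\max_{\mathbf{x}_1,\mathbf{x}_2\in\mathcal{D}}\|\mathbf{x}_1-\mathbf{x}_2\|_2$ is the diameter of $\mathcal{D}$.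
   Context: For $\mathcal{D}\subset\mathbb{R}^m$ and $\mathbf{L}\in\mathbb{R}^{m\times m}$, $$\mathcal{L}(\mathcal{D},\mathbf{L})=\{f:\mathcal{D}\to\mathbb{R}\ :\ |f(\mathbf{x}_1)-f(\mathbf{x}_2)|\le\|\mathbf{L}(\mathbf{x}_1-\mathbf{x}_2)\|_2\ \text{ for all }\mathbf{x}_1,\mathbf{x}_2\in\mathcal{D}\}.$$ *)

theory Defs
  imports "HOL-Analysis.Analysis"
begin

text \<open>Functions on \<open>D\<close> are represented by total functions; values outside \<open>D\<close> are unconstrained.\<close>

definition matrix_lipschitz :: "(real ^ 'm) set \<Rightarrow> real ^ 'm ^ 'm \<Rightarrow> (real ^ 'm \<Rightarrow> real) set"
  where "matrix_lipschitz D L =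
    {f. \<forall>x1\<in>D. \<forall>x2\<in>D. \<bar>f x1 - f x2\<bar> \<le> norm (L *v (x1 - x2))}"

text \<open>The singular values of a square matrix \<open>A\<close> are the nonnegative square roots of the
  eigenvalues of \<open>A\<^sup>T A\<close>.\<close>

definition singular_values :: "real ^ 'm ^ 'm \<Rightarrow> real set"
  where "singular_values A =
    {s. 0 \<le> s \<and> (\<exists>v. v \<noteq> 0 \<and> (transpose A ** A) *v v = s\<^sup>2 *\<^sub>R v)}"

definition sigma_max :: "real ^ 'm ^ 'm \<Rightarrow> real"
  where "sigma_max A = Max (singular_values A)"

text \<open>Unlike the real-valued \<^const>\<open>diameter\<close>, this is \<open>\<infinity>\<close> for unbounded sets.\<close>

definition ediam :: "'a::real_normed_vector set \<Rightarrow> ereal"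
  where "ediam D = (SUP x1\<in>D. SUP x2\<in>D. ereal (norm (x1 - x2)))"

end

theory Submission
  imports Defs
begin

text \<open>
  Write \<open>P = U U\<^sup>T\<close>. To compare \<open>f\<close> with \<open>f'\<close> at \<open>z\<close>, pass through the sample point \<open>x j\<close> that
  is nearest to \<open>z\<close> in the seminorm \<open>v \<mapsto> \<parallel>L P v\<parallel>\<close>:
  \<open>\<bar>f z - f' z\<bar> \<le> \<bar>f z - f (x j)\<bar> + \<bar>f (x j) - f' (x j)\<bar> + \<bar>f' (x j) - f' z\<bar>\<close>.
  The last summand is at most \<open>\<parallel>L P (x j - z)\<parallel>\<close>. Since \<open>L = L P + L (1 - P)\<close>, the first one is at
  most \<open>\<parallel>L P (x j - z)\<parallel> + \<parallel>L (1 - P) (x j - z)\<parallel>\<close>. This accounts for the factor 2 and leaves the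
  residual \<open>\<parallel>L (1 - P) (x j - z)\<parallel>\<close>, which is bounded by the largest singular value times the
  diameter (\<open>norm_mult_le_sigma_max\<close>).

  The remaining point is that the largest singular value, defined through eigenvalues of \<open>A\<^sup>T A\<close>,
  is an operator norm bound for \<open>A\<close>. A maximiser of \<open>\<parallel>A v\<parallel>\<close> on the unit sphere exists by
  compactness and is an eigenvector of \<open>A\<^sup>T A\<close>, so the maximum is itself a singular value
  (\<open>norm_bound_singular_value\<close>); and there are only finitely many singular values
  (\<open>finite_singular_values\<close>), so it lies below their \<open>Max\<close>.
\<close>

lemma inner_gram:
  fixes A :: "real ^ 'n ^ 'm"
  shows "((transpose A ** A) *v v) \<bullet> w = (A *v v) \<bullet> (A *v w)"
  by (metis dot_lmul_matrix inner_commute matrix_vector_mul_assoc transpose_matrix_vector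
      transpose_transpose)

text \<open>Eigenvectors of the symmetric matrix \<open>A\<^sup>T A\<close> for distinct eigenvalues are orthogonal, and a
  finite-dimensional space contains only finitely many pairwise orthogonal nonzero vectors.\<close>

lemma finite_singular_values:
  fixes A :: "real ^ 'm ^ 'm"
  shows "finite (singular_values A)"
proof -
  define e where "e s = (SOME v. v \<noteq> 0 \<and> (transpose A ** A) *v v = s\<^sup>2 *\<^sub>R v)" for s :: real
  have e: "e s \<noteq> 0 \<and> (transpose A ** A) *v e s = s\<^sup>2 *\<^sub>R e s" if "s \<in> singular_values A" for s
  proof -
    have "\<exists>v. v \<noteq> 0 \<and> (transpose A ** A) *v v = s\<^sup>2 *\<^sub>R v"
      using that by (simp add: singular_values_def)
    then show ?thesis unfolding e_def by (rule someI_ex)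
  qed
  have orth: "e s \<bullet> e t = 0"
    if st: "s \<in> singular_values A" "t \<in> singular_values A" "s \<noteq> t" for s t
  proof -
    have "s\<^sup>2 * (e s \<bullet> e t) = ((transpose A ** A) *v e s) \<bullet> e t"
      using e[OF st(1)] by simp
    also have "\<dots> = ((transpose A ** A) *v e t) \<bullet> e s"
      by (simp only: inner_gram) (simp add: inner_commute)
    also have "\<dots> = t\<^sup>2 * (e s \<bullet> e t)"
      using e[OF st(2)] by (simp add: inner_commute)
    finally have "s\<^sup>2 = t\<^sup>2 \<or> e s \<bullet> e t = 0" by auto
    moreover have "s\<^sup>2 \<noteq> t\<^sup>2"
      using st by (auto simp: singular_values_def power2_eq_iff_nonneg)
    ultimately show ?thesis by blast
  qed
  have "inj_on e (singular_values A)"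
    by (rule inj_onI) (metis e orth inner_eq_zero_iff)
  moreover have "pairwise orthogonal (e ` singular_values A)"
    unfolding pairwise_def orthogonal_def using orth by auto
  hence "finite (e ` singular_values A)"
    by (rule pairwise_orthogonal_imp_finite)
  ultimately show ?thesis by (simp add: finite_image_iff)
qed

text \<open>The variational characterisation of the largest singular value. That a maximiser \<open>u\<close> of \<open>\<parallel>A v\<parallel>\<close>
  on the unit sphere is an eigenvector of \<open>A\<^sup>T A\<close> needs no differentiation: with \<open>s = \<parallel>A u\<parallel>\<close> and
  \<open>w = A\<^sup>T A u\<close> one has \<open>w \<bullet> u = s\<^sup>2\<close> and, by Cauchy--Schwarz and maximality, \<open>\<parallel>w\<parallel> \<le> s\<^sup>2\<close>; expanding
  the square then forces \<open>\<parallel>w - s\<^sup>2 u\<parallel> = 0\<close>.\<close>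

lemma norm_bound_singular_value:
  fixes A :: "real ^ 'm ^ 'm"
  obtains s where "s \<in> singular_values A" "\<And>v. norm (A *v v) \<le> s * norm v"
proof -
  have "continuous_on (sphere 0 1) (\<lambda>v. norm (A *v v))"
    by (intro continuous_intros)
  moreover have "sphere (0 :: real ^ 'm) 1 \<noteq> {}" by simp
  ultimately obtain u where u: "norm u = 1"
    and u_max: "\<And>v. norm v = 1 \<Longrightarrow> norm (A *v v) \<le> norm (A *v u)"
    using continuous_attains_sup[OF compact_sphere, of 0 1 "\<lambda>v. norm (A *v v)"]
    by (auto simp: dist_norm)
  define s where "s = norm (A *v u)"
  define w where "w = (transpose A ** A) *v u"
  have bound: "norm (A *v v) \<le> s * norm v" for v
  proof (cases "v = 0")
    case False
    then have "norm (A *v (inverse (norm v) *\<^sub>R v)) \<le> s"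
      unfolding s_def by (intro u_max) simp
    then show ?thesis
      using False by (simp add: matrix_vector_mult_scaleR divide_simps mult.commute)
  qed simp
  have wu: "w \<bullet> u = s\<^sup>2"
    by (simp add: w_def inner_gram s_def power2_norm_eq_inner)
  have "norm w * norm w = (A *v u) \<bullet> (A *v w)"
    by (metis inner_gram w_def power2_norm_eq_inner power2_eq_square)
  also have "\<dots> \<le> s * norm (A *v w)"
    unfolding s_def by (rule norm_cauchy_schwarz)
  also have "\<dots> \<le> s * (s * norm w)"
    using bound[of w] by (intro mult_left_mono) (simp_all add: s_def)
  finally have "norm w * norm w \<le> s\<^sup>2 * norm w"
    by (simp add: power2_eq_square mult.assoc)
  hence "norm w \<le> s\<^sup>2"
    by (cases "w = 0") simp_all
  hence w_le: "w \<bullet> w \<le> s\<^sup>2 * s\<^sup>2"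
    by (metis norm_ge_zero power2_norm_eq_inner power2_eq_square mult_mono')
  have "u \<bullet> u = 1" using u by (simp add: norm_eq_1)
  hence "(w - s\<^sup>2 *\<^sub>R u) \<bullet> (w - s\<^sup>2 *\<^sub>R u) = w \<bullet> w - s\<^sup>2 * s\<^sup>2"
    using wu by (simp add: inner_diff inner_commute[of u w])
  also have "\<dots> \<le> 0" using w_le by simp
  finally have "w = s\<^sup>2 *\<^sub>R u"
    by (metis eq_iff_diff_eq_0 inner_ge_zero inner_eq_zero_iff order_antisym)
  moreover have "u \<noteq> 0" using u by auto
  ultimately have "s \<in> singular_values A"
    unfolding singular_values_def w_def by (auto simp: s_def)
  then show ?thesis using bound that by blast
qed

lemma sigma_max_nonneg:
  fixes A :: "real ^ 'm ^ 'm"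
  shows "0 \<le> sigma_max A"
proof -
  obtain s where s: "s \<in> singular_values A"
    using norm_bound_singular_value by blast
  then have "0 \<le> s" by (simp add: singular_values_def)
  also have "s \<le> sigma_max A"
    unfolding sigma_max_def using finite_singular_values s by (rule Max_ge)
  finally show ?thesis .
qed

lemma norm_mult_le_sigma_max:
  fixes A :: "real ^ 'm ^ 'm"
  shows "norm (A *v v) \<le> sigma_max A * norm v"
proof -
  obtain s where s: "s \<in> singular_values A" "norm (A *v v) \<le> s * norm v"
    using norm_bound_singular_value by blast
  have "s \<le> sigma_max A"
    unfolding sigma_max_def using finite_singular_values s(1) by (rule Max_ge)
  then show ?thesis
    using s(2) mult_right_mono[of s "sigma_max A" "norm v"] by simp
qed

lemma norm_le_ediam:
  assumes "a \<in> D" "b \<in> D"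
  shows "ereal (norm (a - b)) \<le> ediam D"
  unfolding ediam_def using assms by (blast intro: SUP_upper2)

text \<open>The pointwise form of the bound, from splitting \<open>L = L P + L (1 - P)\<close>: \<open>f'\<close> contributes one
  copy of \<open>\<parallel>L P (y - z)\<parallel>\<close>, and \<open>f\<close> the second copy together with the residual term.\<close>

lemma matrix_lipschitz_error_via_sample:
  fixes L P :: "real ^ 'm ^ 'm"
  assumes f: "f \<in> matrix_lipschitz D L" and f': "f' \<in> matrix_lipschitz D (L ** P)"
    and D: "y \<in> D" "z \<in> D"
  shows "\<bar>f z - f' z\<bar> \<le> \<bar>f y - f' y\<bar> + 2 * norm ((L ** P) *v (y - z))
           + sigma_max (L ** (mat 1 - P)) * norm (y - z)"
proof -
  have "L = L ** P + L ** (mat 1 - P)"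
    by (simp flip: matrix_add_ldistrib)
  then have "L *v (y - z) = (L ** P) *v (y - z) + (L ** (mat 1 - P)) *v (y - z)"
    by (metis matrix_vector_mult_add_rdistrib)
  then have "norm (L *v (y - z))
      \<le> norm ((L ** P) *v (y - z)) + norm ((L ** (mat 1 - P)) *v (y - z))"
    by (simp add: norm_triangle_ineq)
  moreover have "\<bar>f y - f z\<bar> \<le> norm (L *v (y - z))"
    and "\<bar>f' y - f' z\<bar> \<le> norm ((L ** P) *v (y - z))"
    using f f' D by (auto simp: matrix_lipschitz_def)
  ultimately show ?thesis
    using norm_mult_le_sigma_max[of "L ** (mat 1 - P)" "y - z"] by linarith
qed

theorem theorem4p1:
  fixes D :: "(real ^ 'm) set"
    and L :: "real ^ 'm ^ 'm"
    and U :: "real ^ 'n ^ 'm"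
    and f f' :: "real ^ 'm \<Rightarrow> real"
    and x :: "nat \<Rightarrow> real ^ 'm"
    and M :: nat
  assumes "f \<in> matrix_lipschitz D L"
    and "f' \<in> matrix_lipschitz D (L ** U ** transpose U)"
    and "transpose U ** U = mat 1"
    and "M \<ge> 1"
    and "x ` {1..M} \<subseteq> D"
  shows "(SUP z\<in>D. ereal \<bar>f z - f' z\<bar>)
    \<le> ereal (MAX j\<in>{1..M}. \<bar>f (x j) - f' (x j)\<bar>)
      + 2 * (SUP z\<in>D. ereal (MIN j\<in>{1..M}. norm ((L ** U ** transpose U) *v (x j - z))))
      + ereal (sigma_max (L ** (mat 1 - U ** transpose U))) * ediam D"
proof (rule SUP_least)
  fix z assume z: "z \<in> D"
  define P where "P = U ** transpose U"
  have LP: "L ** U ** transpose U = L ** P"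
    by (simp add: P_def matrix_mul_assoc)
  let ?d = "\<lambda>z j. norm ((L ** P) *v (x j - z))"
  let ?\<sigma> = "sigma_max (L ** (mat 1 - P))"
  \<comment> \<open>\<open>M \<ge> 1\<close> is what makes the minimum over the sample points attained.\<close>
  have "Min (?d z ` {1..M}) \<in> ?d z ` {1..M}"
    using assms(4) by (intro Min_in) auto
  then obtain j where j: "j \<in> {1..M}" and d_j: "?d z j = (MIN j\<in>{1..M}. ?d z j)"
    by auto
  have xj: "x j \<in> D" using assms(5) j by auto
  have "ereal \<bar>f z - f' z\<bar>
      \<le> ereal \<bar>f (x j) - f' (x j)\<bar> + 2 * ereal (?d z j) + ereal ?\<sigma> * ereal (norm (x j - z))"
    using matrix_lipschitz_error_via_sample[OF assms(1) assms(2)[unfolded LP] xj z]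
    by (simp add: numeral_eq_ereal)
  also have "\<dots> \<le> ereal (MAX j\<in>{1..M}. \<bar>f (x j) - f' (x j)\<bar>)
      + 2 * (SUP z\<in>D. ereal (MIN j\<in>{1..M}. ?d z j)) + ereal ?\<sigma> * ediam D"
  proof (intro add_mono ereal_mult_left_mono)
    show "ereal \<bar>f (x j) - f' (x j)\<bar> \<le> ereal (MAX j\<in>{1..M}. \<bar>f (x j) - f' (x j)\<bar>)"
      using j by simp
    show "ereal (?d z j) \<le> (SUP z\<in>D. ereal (MIN j\<in>{1..M}. ?d z j))"
      unfolding d_j using z by (rule SUP_upper)
    show "ereal (norm (x j - z)) \<le> ediam D"
      using xj z by (rule norm_le_ediam)
  qed (simp_all add: sigma_max_nonneg)
  finally show "ereal \<bar>f z - f' z\<bar> \<le> ereal (MAX j\<in>{1..M}. \<bar>f (x j) - f' (x j)\<bar>)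
      + 2 * (SUP z\<in>D. ereal (MIN j\<in>{1..M}. norm ((L ** U ** transpose U) *v (x j - z))))
      + ereal (sigma_max (L ** (mat 1 - U ** transpose U))) * ediam D"
    unfolding LP P_def .
qed

end
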